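(* Let $X$ and $Y$ be two real random variables with finite means and distribution functions $F$ and $G$, respectively, write $\overline F=1-F$, $\overline G=1-G$, and let $p_0\in(0,1)$ be such that $F^{-1}(p_0)\leq G^{-1}(p_0)$. Then $X\leq_{p_0\text{-tvar}}Y$ if, and only if, one of the following equivalent conditions holds: (i) $\mathrm{E}[(X-x)_+]\leq \mathrm{E}[(Y-x)_+]$ for all $x\geq F^{-1}(p_0)$; (ii) $\int_{x}^{+\infty}\overline F(t)\,dt\leq\int_{x}^{+\infty}\overline G(t)\,dt$ for all $x\geq F^{-1}(p_0)$. (That is, $X\leq_{p_0\text{-tvar}}Y$, (i) and (ii) are all equivalent.)
   Context: For a random variable $X$ with distribution function $F$, the quantile function is $F^{-1}(p)=\inf\{x: F(x)\geq p\}$ for $p\in(0,1)$, and the tail value at risk is $\mathrm{TVaR}_p(X)=\frac{1}{1-p}\int_p^1 F^{-1}(u)\,du$ for $p\in[0,1)$. For $p_0\in[0,1)$, $X\leq_{p_0\text{-tvar}}Y$ means that $\mathrm{TVaR}_p(X)\leq\mathrm{TVaR}_p(Y)$ for all $p\in(p_0,1)$. Also $(x)_+=\max\{x,0\}$. *)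

theory Defs
  imports "HOL-Probability.Probability"
begin

text \<open>The argument \<open>F\<close> is a distribution function. The value is meaningful only for \<open>0 < p < 1\<close>,
  where the set below is nonempty and bounded below.\<close>

definition quantile :: "(real \<Rightarrow> real) \<Rightarrow> real \<Rightarrow> real" where
  "quantile F p = Inf {x. F x \<ge> p}"

definition tvar :: "'a measure \<Rightarrow> ('a \<Rightarrow> real) \<Rightarrow> real \<Rightarrow> real" where
  "tvar M X p = 1 / (1 - p) * (LBINT u=p..1. quantile (cdf (distr M borel X)) u)"

text \<open>The order compares only the laws of \<open>X\<close> and \<open>Y\<close>, so they may live on different
  probability spaces.\<close>

definition tvar_le ::
  "real \<Rightarrow> 'a measure \<Rightarrow> ('a \<Rightarrow> real) \<Rightarrow> 'b measure \<Rightarrow> ('b \<Rightarrow> real) \<Rightarrow> bool" where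
  "tvar_le p0 M X N Y \<longleftrightarrow> (\<forall>p\<in>{p0<..<1}. tvar M X p \<le> tvar N Y p)"

end

theory Submission
  imports Defs
begin

text \<open>
  Write \<open>Q\<close> for the quantile function of a law with finite mean and distribution function \<open>F\<close>, \<open>S x\<close> for the
  expected excess \<open>E[(X - x)\<^sub>+]\<close> (the stop-loss transform) and \<open>T p\<close> for the integral of \<open>Q\<close>
  over \<open>(p, 1)\<close>, so that the tail value at risk at \<open>p\<close> is \<open>T p / (1 - p)\<close>. The proof rests on
  the variational formula of Rockafellar and Uryasev, which for \<open>0 < p < 1\<close> reads
  \<open>T p = min\<^sub>x ((1 - p) x + S x)\<close>. Indeed \<open>Q\<close> pushes the uniform law on \<open>(0, 1)\<close> forward to the
  given law, so \<open>S x\<close> is the integral of \<open>(Q - x)\<^sub>+\<close> over \<open>(0, 1)\<close>, whereas \<open>T p - (1 - p) x\<close> is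
  the integral of \<open>Q - x\<close> over \<open>(p, 1)\<close> only. The former dominates
  (\<open>tail_quantile_le\<close>), with equality when \<open>Q \<le> x\<close> up to \<open>p\<close> and \<open>x \<le> Q\<close> beyond \<open>p\<close>
  (\<open>tail_quantile_eq\<close>). This happens for \<open>x = Q p\<close>, and also for \<open>p = F x\<close>, since \<open>Q u \<le> x\<close> is
  equivalent to \<open>u \<le> F x\<close>.

  Both directions of the comparison of two laws \<open>\<mu>\<close> and \<open>\<nu>\<close> follow by choosing the point at
  which one of the two sides is an equality. From stop-loss to tail integrals, one evaluates
  at \<open>x = Q\<^sub>\<nu> p\<close>, where \<open>T\<^sub>\<nu> p\<close> attains its minimum; the assumption \<open>Q\<^sub>\<mu> p0 \<le> Q\<^sub>\<nu> p0\<close> ensures that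
  this \<open>x\<close> lies in the range where the stop-loss inequality is known. From tail integrals to
  stop-loss, one evaluates at \<open>p = F\<^sub>\<mu> x\<close>, where \<open>S\<^sub>\<mu> x\<close> is exactly \<open>T\<^sub>\<mu> p - (1 - p) x\<close>. Here
  \<open>p \<ge> p0\<close>, but \<open>p = p0\<close> can occur, for instance when \<open>F\<^sub>\<mu>\<close> is continuous; that
  boundary case is reached by right-continuity of \<open>T\<close>. The equivalence with the integrated
  survival functions is the layer-cake identity \<open>stop_loss_eq_survival_integral\<close>.
\<close>

section \<open>Stop-loss transforms and tail integrals of the quantile function\<close>

definition stop_loss :: "real measure \<Rightarrow> real \<Rightarrow> real" where
  "stop_loss \<mu> x = (\<integral>y. max (y - x) 0 \<partial>\<mu>)"

text \<open>The factor \<open>1 / (1 - p)\<close> of the tail value at risk is omitted: it is positive and the same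
  for every law, so it does not affect comparisons, and without it the variational formula is
  a minimum of functions affine in \<open>p\<close>.\<close>

definition tail_quantile :: "real measure \<Rightarrow> real \<Rightarrow> real" where
  "tail_quantile \<mu> p = (LBINT u=p..1. quantile (cdf \<mu>) u)"

lemma tail_quantile_eq_set_integral:
  assumes "p < 1"
  shows "tail_quantile \<mu> p = (LBINT u:{p<..<1}. quantile (cdf \<mu>) u)"
  using assms by (simp add: tail_quantile_def interval_lebesgue_integral_def one_ereal_def)

context cdf_distribution
begin

text \<open>Right-continuity of \<open>C\<close> makes the infimum that defines the quantile a minimum, which gives the
  following adjunction between the quantile function and \<open>C\<close>.\<close>

lemma quantile_le_iff:
  assumes "0 < u" "u < 1"
  shows "quantile C u \<le> x \<longleftrightarrow> u \<le> C x"
  using pseudoinverse[OF assms, of x] by (simp add: quantile_def)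

lemma quantile_mono:
  assumes "0 < u" "u \<le> v" "v < 1"
  shows "quantile C u \<le> quantile C v"
  using assms quantile_le_iff[of u "quantile C v"] quantile_le_iff[of v "quantile C v"] by simp

lemma quantile_measurable: "quantile C \<in> borel_measurable (restrict_space lborel {0<..<1})"
  unfolding quantile_def[abs_def]
    measurable_cong_sets[OF sets_restrict_space_cong[OF sets_lborel] refl]
  by (rule measurable_CI)

text \<open>Inverse transform sampling: the quantile function of a uniform variable on \<open>(0, 1)\<close> has law
  \<open>M\<close>, so integrals against \<open>M\<close> become Lebesgue integrals over \<open>(0, 1)\<close>.\<close>

lemma integral_eq_quantile_integral:
  fixes f :: "real \<Rightarrow> real"
  assumes "f \<in> borel_measurable borel"
  shows "(\<integral>y. f y \<partial>M) = (LBINT u:{0<..<1}. f (quantile C u))"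
proof -
  have "(\<integral>y. f y \<partial>M) = (\<integral>u. f (quantile C u) \<partial>restrict_space lborel {0<..<1})"
    using assms quantile_measurable
    by (subst distr_I_eq_M[symmetric], subst integral_distr) (auto simp: quantile_def[abs_def])
  also have "\<dots> = (LBINT u:{0<..<1}. f (quantile C u))"
    by (subst integral_restrict_space) (auto simp: set_lebesgue_integral_def)
  finally show ?thesis .
qed

lemma set_integrable_comp_quantile:
  assumes "integrable M f" "f \<in> borel_measurable borel"
  shows "set_integrable lborel {0<..<1} (\<lambda>u. f (quantile C u) :: real)"
proof -
  have "integrable (distr (restrict_space lborel {0<..<1}) borel (quantile C)) f"
    using assms(1) distr_I_eq_M by (simp add: quantile_def[abs_def])
  then have "integrable (restrict_space lborel {0<..<1}) (\<lambda>u. f (quantile C u))"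
    using quantile_measurable assms(2) by (subst (asm) integrable_distr_eq) auto
  then show ?thesis
    by (subst (asm) integrable_restrict_space) (auto simp: set_integrable_def)
qed

lemma set_integrable_quantile:
  assumes "integrable M (\<lambda>y. y)" "0 \<le> a"
  shows "set_integrable lborel {a<..<1} (quantile C)"
proof (rule set_integrable_subset)
  show "set_integrable lborel {0<..<1} (quantile C)"
    using assms(1) by (rule set_integrable_comp_quantile) simp
qed (use assms in auto)

text \<open>The excess \<open>(y - x)\<^sub>+\<close> is the length of the interval \<open>(x, y)\<close>. Integrating this
  length over \<open>y\<close> and exchanging the order of integration leaves, for each level \<open>t > x\<close>, the
  probability of exceeding \<open>t\<close>. All integrands are nonnegative, so Tonelli's theorem applies; if
  the mean excess is infinite, neither side is integrable and both integrals are \<open>0\<close> by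
  convention.\<close>

lemma stop_loss_eq_survival_integral:
  "stop_loss M x = (LBINT t=x..\<infinity>. 1 - C t)"
proof -
  interpret pair_sigma_finite M lborel ..
  have layer: "ennreal (max (y - x) 0) = (\<integral>\<^sup>+t. indicator {x<..<y} t \<partial>lborel)" for y
    by (cases "x \<le> y") (auto simp: max_def)
  have survival: "(\<integral>\<^sup>+y. indicator {x<..<y} t \<partial>M)
      = ennreal (indicator {x<..} t *\<^sub>R (1 - C t))" for t
  proof -
    have "(\<integral>\<^sup>+y. indicator {x<..<y} t \<partial>M)
        = (\<integral>\<^sup>+y. indicator {x<..} t * indicator {t<..} y \<partial>M)"
      by (intro nn_integral_cong) (auto simp: indicator_def)
    also have "\<dots> = indicator {x<..} t * emeasure M {t<..}"
      by (subst nn_integral_cmult) auto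
    also have "emeasure M {t<..} = ennreal (1 - C t)"
    proof -
      have "{t<..} = space M - {..t}" by auto
      then show ?thesis
        using prob_compl[of "{..t}"] by (simp add: emeasure_eq_measure cdf_def)
    qed
    finally show ?thesis by (auto simp: indicator_def)
  qed
  have "case_prod (\<lambda>y t. indicator {x<..<y} t :: ennreal) \<in> borel_measurable (borel \<Otimes>\<^sub>M borel)"
    unfolding indicator_def greaterThanLessThan_iff by measurable
  then have indicator_measurable:
    "case_prod (\<lambda>y t. indicator {x<..<y} t :: ennreal) \<in> borel_measurable (M \<Otimes>\<^sub>M lborel)"
    by (simp only: measurable_cong_sets[OF sets_pair_measure_cong[OF events_eq_borel sets_lborel] refl])
  have "(\<integral>\<^sup>+y. ennreal (max (y - x) 0) \<partial>M)
      = (\<integral>\<^sup>+y. \<integral>\<^sup>+t. indicator {x<..<y} t \<partial>lborel \<partial>M)"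
    by (simp only: layer)
  also have "\<dots> = (\<integral>\<^sup>+t. \<integral>\<^sup>+y. indicator {x<..<y} t \<partial>M \<partial>lborel)"
    using indicator_measurable by (rule Fubini'[symmetric])
  also have "\<dots> = (\<integral>\<^sup>+t. ennreal (indicator {x<..} t *\<^sub>R (1 - C t)) \<partial>lborel)"
    by (simp only: survival)
  finally have nn: "(\<integral>\<^sup>+y. ennreal (max (y - x) 0) \<partial>M)
      = (\<integral>\<^sup>+t. ennreal (indicator {x<..} t *\<^sub>R (1 - C t)) \<partial>lborel)" .
  have "stop_loss M x = enn2real (\<integral>\<^sup>+y. ennreal (max (y - x) 0) \<partial>M)"
    unfolding stop_loss_def by (rule integral_eq_nn_integral) auto
  also have "\<dots> = (\<integral>t. indicator {x<..} t *\<^sub>R (1 - C t) \<partial>lborel)"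
    unfolding nn by (rule integral_eq_nn_integral[symmetric]) (auto simp: cdf_bounded_prob)
  finally show ?thesis
    by (simp add: interval_integral_to_infinity_eq set_lebesgue_integral_def)
qed

section \<open>The variational formula\<close>

text \<open>The integral over \<open>(p, 1)\<close> is written as an integral over all of \<open>(0, 1)\<close> with an indicator
  so that it can be compared pointwise with the integrand \<open>(Q - x)\<^sub>+\<close> of the stop-loss
  transform.\<close>

lemma tail_quantile_excess:
  assumes "integrable M (\<lambda>y. y)" "0 < p" "p < 1"
  shows "set_integrable lborel {0<..<1} (\<lambda>u. indicator {p<..<1} u * (quantile C u - x))"
    and "tail_quantile M p
      = (1 - p) * x + (LBINT u:{0<..<1}. indicator {p<..<1} u * (quantile C u - x))"
proof -
  have Q: "set_integrable lborel {p<..<1} (quantile C)"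
    using assms by (simp add: set_integrable_quantile)
  have const: "set_integrable lborel {p<..<1} (\<lambda>_. x)"
    using assms by (auto simp: set_integrable_def intro!: integrable_real_indicator)
  have restrict: "indicator {0<..<1} u *\<^sub>R (indicator {p<..<1} u * (quantile C u - x))
      = indicator {p<..<1} u *\<^sub>R (quantile C u - x)" for u
    using assms by (auto simp: indicator_def)
  show "set_integrable lborel {0<..<1} (\<lambda>u. indicator {p<..<1} u * (quantile C u - x))"
    using set_integral_diff(1)[OF Q const] unfolding set_integrable_def restrict .
  have "(LBINT u:{0<..<1}. indicator {p<..<1} u * (quantile C u - x))
      = (LBINT u:{p<..<1}. quantile C u - x)"
    unfolding set_lebesgue_integral_def restrict ..
  also have "\<dots> = (LBINT u:{p<..<1}. quantile C u) - (LBINT u:{p<..<1}. x)"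
    using Q const by simp
  also have "(LBINT u:{p<..<1}. x) = (1 - p) * x"
    using assms by (simp add: set_integral_const)
  finally show "tail_quantile M p
      = (1 - p) * x + (LBINT u:{0<..<1}. indicator {p<..<1} u * (quantile C u - x))"
    using assms by (simp add: tail_quantile_eq_set_integral)
qed

lemma stop_loss_eq_quantile_integral:
  "stop_loss M x = (LBINT u:{0<..<1}. max (quantile C u - x) 0)"
  unfolding stop_loss_def by (rule integral_eq_quantile_integral) measurable

text \<open>Cutting \<open>Q - x\<close> off at \<open>p\<close> yields at most its positive part, whatever its sign.\<close>

lemma tail_quantile_le:
  assumes "integrable M (\<lambda>y. y)" "0 < p" "p < 1"
  shows "tail_quantile M p \<le> (1 - p) * x + stop_loss M x"
proof -
  have "integrable M (\<lambda>y. max (y - x) 0)"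
    by (intro integrable_max Bochner_Integration.integrable_diff integrable_const integrable_zero
        assms(1))
  then have "set_integrable lborel {0<..<1} (\<lambda>u. max (quantile C u - x) 0)"
    by (rule set_integrable_comp_quantile) measurable
  with tail_quantile_excess(1)[OF assms]
  have "(LBINT u:{0<..<1}. indicator {p<..<1} u * (quantile C u - x)) \<le> stop_loss M x"
    unfolding stop_loss_eq_quantile_integral
    by (rule set_integral_mono) (simp add: indicator_def)
  then show ?thesis
    using tail_quantile_excess(2)[OF assms, of x] by simp
qed

text \<open>If the quantile function crosses the level \<open>x\<close> at \<open>p\<close>, cutting \<open>Q - x\<close> off at \<open>p\<close> yields
  exactly its positive part. The level \<open>x\<close> may lie anywhere inside a jump of \<open>Q\<close> at \<open>p\<close>, and \<open>p\<close>
  anywhere inside a flat piece of \<open>Q\<close> at height \<open>x\<close>; the next two lemmas are the two extreme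
  choices.\<close>

lemma tail_quantile_eq:
  assumes "integrable M (\<lambda>y. y)" "0 < p" "p < 1"
    and below: "\<And>u. 0 < u \<Longrightarrow> u \<le> p \<Longrightarrow> quantile C u \<le> x"
    and above: "\<And>u. p < u \<Longrightarrow> u < 1 \<Longrightarrow> x \<le> quantile C u"
  shows "tail_quantile M p = (1 - p) * x + stop_loss M x"
proof -
  have "(LBINT u:{0<..<1}. indicator {p<..<1} u * (quantile C u - x)) = stop_loss M x"
    unfolding stop_loss_eq_quantile_integral
  proof (intro set_lebesgue_integral_cong allI impI)
    show "indicator {p<..<1} u * (quantile C u - x) = max (quantile C u - x) 0"
      if "u \<in> {0<..<1}" for u
      using that below[of u] above[of u] by (cases "u \<le> p") auto
  qed simp
  then show ?thesis
    using tail_quantile_excess(2)[OF assms(1-3), of x] by simp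
qed

lemma tail_quantile_at_quantile:
  assumes "integrable M (\<lambda>y. y)" "0 < p" "p < 1"
  shows "tail_quantile M p = (1 - p) * quantile C p + stop_loss M (quantile C p)"
  using assms by (intro tail_quantile_eq) (auto intro: quantile_mono)

lemma tail_quantile_at_cdf:
  assumes "integrable M (\<lambda>y. y)" "0 < C x" "C x < 1"
  shows "tail_quantile M (C x) = (1 - C x) * x + stop_loss M x"
proof (rule tail_quantile_eq[OF assms])
  show "quantile C u \<le> x" if "0 < u" "u \<le> C x" for u
    using that assms by (simp add: quantile_le_iff)
  show "x \<le> quantile C u" if "C x < u" "u < 1" for u
    using that assms quantile_le_iff[of u x] by simp
qed

lemma stop_loss_eq_0:
  assumes "C x = 1"
  shows "stop_loss M x = 0"
proof -
  have "stop_loss M x = (LBINT u:{0<..<1::real}. 0)"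
    unfolding stop_loss_eq_quantile_integral
  proof (intro set_lebesgue_integral_cong allI impI)
    show "max (quantile C u - x) 0 = 0" if "u \<in> {0<..<1}" for u
      using that assms quantile_le_iff[of u x] by simp
  qed simp
  then show ?thesis by simp
qed

lemma stop_loss_nonneg: "0 \<le> stop_loss M x"
  unfolding stop_loss_def by (rule integral_nonneg_AE) auto

text \<open>The tail comparison is assumed only for \<open>p > p0\<close>; this limit extends it to \<open>p0\<close> itself. The
  convergence result for set integrals is about half-closed intervals, which is why the endpoint \<open>1\<close>
  is added. The value of the quantile there is arbitrary, but a single point has measure
  zero.\<close>

lemma tail_quantile_tendsto_at_right:
  assumes "integrable M (\<lambda>y. y)" "0 < p" "p < 1"
  shows "(tail_quantile M \<longlongrightarrow> tail_quantile M p) (at_right p)"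
proof -
  have "set_integrable lborel {p<..<1} (quantile C)"
    using assms by (simp add: set_integrable_quantile)
  moreover have "set_integrable lborel {1} (quantile C)"
  proof -
    have "(\<lambda>u. indicator {1} u *\<^sub>R quantile C u) = (\<lambda>u. indicator {1} u *\<^sub>R quantile C 1)"
      by (auto simp: indicator_def)
    then show ?thesis by (auto simp: set_integrable_def intro!: integrable_real_indicator)
  qed
  ultimately have "set_integrable lborel ({p<..<1} \<union> {1}) (quantile C)"
    by (intro set_integrable_Un) auto
  also have "{p<..<1} \<union> {1} = {p<..1}"
    using assms by auto
  finally have "((\<lambda>a. LBINT u:{a..1}. quantile C u) \<longlongrightarrow> (LBINT u:{p<..1}. quantile C u)) (at_right p)"
    using assms by (intro tendsto_set_lebesgue_integral_at_right) auto
  moreover have "\<forall>\<^sub>F a in at_right p. (LBINT u:{a..1}. quantile C u) = tail_quantile M a"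
    using eventually_at_right_real[OF assms(3)]
    by eventually_elim (use interval_integral_Icc[of _ 1 "quantile C"] in
        \<open>auto simp: tail_quantile_def one_ereal_def\<close>)
  moreover have "(LBINT u:{p<..1}. quantile C u) = tail_quantile M p"
    using assms interval_integral_Ioc[of p 1 "quantile C"]
    by (simp add: tail_quantile_def one_ereal_def)
  ultimately show ?thesis
    by (simp add: tendsto_cong)
qed

end

section \<open>Comparison of two laws\<close>

text \<open>The two functions carry the same information by the variational formula. Each direction
  needs equality for one law and the inequality \<open>T p \<le> (1 - p) x + S x\<close> for the other.\<close>

lemma stop_loss_le_iff_tail_quantile_le:
  assumes \<mu>: "cdf_distribution \<mu>" "integrable \<mu> (\<lambda>y. y)"
    and \<nu>: "cdf_distribution \<nu>" "integrable \<nu> (\<lambda>y. y)"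
    and p0: "0 < p0" "p0 < 1"
    and start: "quantile (cdf \<mu>) p0 \<le> quantile (cdf \<nu>) p0"
  shows "(\<forall>p\<in>{p0<..<1}. tail_quantile \<mu> p \<le> tail_quantile \<nu> p)
     \<longleftrightarrow> (\<forall>x\<ge>quantile (cdf \<mu>) p0. stop_loss \<mu> x \<le> stop_loss \<nu> x)" (is "?tail \<longleftrightarrow> ?loss")
proof -
  interpret \<mu>: cdf_distribution \<mu> by fact
  interpret \<nu>: cdf_distribution \<nu> by fact
  show ?thesis
  proof (intro iffI allI impI ballI)
    fix x assume tail: ?tail and x: "quantile (cdf \<mu>) p0 \<le> x"
    let ?p = "cdf \<mu> x"
    have "p0 \<le> ?p"
      using x p0 by (simp add: \<mu>.quantile_le_iff)
    have at_p0: "tail_quantile \<mu> p0 \<le> tail_quantile \<nu> p0"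
    proof (rule tendsto_le)
      show "\<forall>\<^sub>F p in at_right p0. tail_quantile \<mu> p \<le> tail_quantile \<nu> p"
        using eventually_at_right_real[OF p0(2)] by eventually_elim (use tail in auto)
    qed (use \<mu>.tail_quantile_tendsto_at_right \<nu>.tail_quantile_tendsto_at_right \<mu> \<nu> p0 in auto)
    \<comment> \<open>If \<open>x\<close> lies at or above the essential supremum of \<open>\<mu>\<close>, no level \<open>p < 1\<close> corresponds
      to it, but then \<open>stop_loss \<mu> x\<close> vanishes.\<close>
    show "stop_loss \<mu> x \<le> stop_loss \<nu> x"
    proof (cases "?p = 1")
      case True
      then show ?thesis
        by (simp add: \<mu>.stop_loss_eq_0 \<nu>.stop_loss_nonneg)
    next
      case False
      then have p: "0 < ?p" "?p < 1"
        using \<open>p0 \<le> ?p\<close> p0 \<mu>.cdf_bounded_prob[of x] by auto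
      have "(1 - ?p) * x + stop_loss \<mu> x = tail_quantile \<mu> ?p"
        using p \<mu> by (simp add: \<mu>.tail_quantile_at_cdf)
      also have "\<dots> \<le> tail_quantile \<nu> ?p"
        using at_p0 tail \<open>p0 \<le> ?p\<close> p by (cases "?p = p0") auto
      also have "\<dots> \<le> (1 - ?p) * x + stop_loss \<nu> x"
        using p \<nu> by (intro \<nu>.tail_quantile_le)
      finally show ?thesis by simp
    qed
  next
    fix p assume loss: ?loss and p: "p \<in> {p0<..<1}"
    let ?x = "quantile (cdf \<nu>) p"
    have "quantile (cdf \<mu>) p0 \<le> ?x"
      using start \<nu>.quantile_mono[of p0 p] p0 p by auto
    have "tail_quantile \<mu> p \<le> (1 - p) * ?x + stop_loss \<mu> ?x"
      using p p0 \<mu> by (intro \<mu>.tail_quantile_le) auto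
    also have "\<dots> \<le> (1 - p) * ?x + stop_loss \<nu> ?x"
      using loss \<open>quantile (cdf \<mu>) p0 \<le> ?x\<close> by simp
    also have "\<dots> = tail_quantile \<nu> p"
      using p p0 \<nu> by (simp add: \<nu>.tail_quantile_at_quantile)
    finally show "tail_quantile \<mu> p \<le> tail_quantile \<nu> p" .
  qed
qed

theorem corollary2p8:
  fixes M :: "'a measure" and N :: "'b measure"
    and X :: "'a \<Rightarrow> real" and Y :: "'b \<Rightarrow> real"
    and F G :: "real \<Rightarrow> real" and p0 :: real
  assumes "prob_space M" and "prob_space N"
    and "X \<in> borel_measurable M" and "Y \<in> borel_measurable N"
    and "integrable M X" and "integrable N Y"
    and "F = cdf (distr M borel X)" and "G = cdf (distr N borel Y)"
    and "0 < p0" and "p0 < 1"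
    and "quantile F p0 \<le> quantile G p0"
  shows "(tvar_le p0 M X N Y \<longleftrightarrow>
           (\<forall>x\<ge>quantile F p0. (\<integral>\<omega>. max (X \<omega> - x) 0 \<partial>M) \<le> (\<integral>\<omega>. max (Y \<omega> - x) 0 \<partial>N)))
       \<and> (tvar_le p0 M X N Y \<longleftrightarrow>
           (\<forall>x\<ge>quantile F p0. (LBINT t=x..\<infinity>. 1 - F t) \<le> (LBINT t=x..\<infinity>. 1 - G t)))"
proof -
  let ?\<mu> = "distr M borel X" and ?\<nu> = "distr N borel Y"
  have \<mu>: "cdf_distribution ?\<mu>" "integrable ?\<mu> (\<lambda>y. y)"
    using assms by (auto simp: cdf_distribution_def integrable_distr_eq prob_space.real_distribution_distr)
  have \<nu>: "cdf_distribution ?\<nu>" "integrable ?\<nu> (\<lambda>y. y)"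
    using assms by (auto simp: cdf_distribution_def integrable_distr_eq prob_space.real_distribution_distr)
  have "tvar_le p0 M X N Y \<longleftrightarrow> (\<forall>p\<in>{p0<..<1}. tail_quantile ?\<mu> p \<le> tail_quantile ?\<nu> p)"
    by (auto simp: tvar_le_def tvar_def tail_quantile_def divide_right_mono divide_le_cancel)
  also have "\<dots> \<longleftrightarrow> (\<forall>x\<ge>quantile F p0. stop_loss ?\<mu> x \<le> stop_loss ?\<nu> x)"
    using stop_loss_le_iff_tail_quantile_le[OF \<mu> \<nu>] assms by simp
  finally have "tvar_le p0 M X N Y \<longleftrightarrow> (\<forall>x\<ge>quantile F p0. stop_loss ?\<mu> x \<le> stop_loss ?\<nu> x)" .
  moreover have "stop_loss ?\<mu> x = (\<integral>\<omega>. max (X \<omega> - x) 0 \<partial>M)"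
    "stop_loss ?\<nu> x = (\<integral>\<omega>. max (Y \<omega> - x) 0 \<partial>N)" for x
    unfolding stop_loss_def using assms by (auto simp: integral_distr)
  moreover have "stop_loss ?\<mu> x = (LBINT t=x..\<infinity>. 1 - F t)"
    "stop_loss ?\<nu> x = (LBINT t=x..\<infinity>. 1 - G t)" for x
    unfolding \<open>F = _\<close> \<open>G = _\<close>
    by (rule cdf_distribution.stop_loss_eq_survival_integral[OF \<mu>(1)],
        rule cdf_distribution.stop_loss_eq_survival_integral[OF \<nu>(1)])
  ultimately show ?thesis by simp
qed

end
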